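(* The eigenvalues of $A$ are $\{\theta_i\}_{i=0}^N$, where \[ \theta_i=\frac{\varphi q^{N-i}-q^i}{q-1}\qquad(0\le i\le N). \] For $0\le i\le N$ the $\theta_i$-eigenspace of $A$ has dimension $\binom{N}{i}_q$.
   Context: Let $q$ be a prime power, $GF(q)$ the field with $q$ elements, $N\ge 1$ an integer, and $\mathbf V$ an $N$-dimensional vector space over $GF(q)$. Let $X$ be the set of all subspaces of $\mathbf V$, ordered by inclusion (the projective geometry $L_N(q)$). For $y,z\in X$, $y$ covers $z$ means $z\subseteq y$ and $\dim y-\dim z=1$. ${\rm Mat}_X(\mathbb C)$ is the algebra of complex matrices with rows and columns indexed by $X$; it acts on $V=\mathbb C^X$ by left multiplication. Fix a real number $\varphi>0$. The matrix $A\in{\rm Mat}_X(\mathbb C)$ has $(y,z)$-entry $1$ if $y$ covers $z$; $\varphi q^{\dim y}$ if $z$ covers $y$; $\frac{\varphi-1}{q-1}q^{\dim y}$ if $y=z$; and $0$ otherwise. For an integer $n\ge0$ put $[n]_q=\frac{q^n-1}{q-1}$, $[n]_q^!=[n]_q[n-1]_q\cdots[1]_q$ (with $[0]_q^!=1$), and $\binom{n}{i}_q=\frac{[n]_q^!}{[i]_q^![n-i]_q^!}$ for $0\le i\le n$. *)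

theory Defs
  imports Complex_Main "HOL-Library.Function_Algebras" "HOL-Library.Cardinality"
begin

section \<open>Complex matrices with rows and columns indexed by a finite set\<close>

text \<open>
  A matrix in \<open>Mat\<^sub>X(\<complex>)\<close> is given by its entry function, only the entries with both indices
  in \<open>X\<close> being relevant.  The space \<open>\<complex>\<^sup>X\<close> consists of the functions that vanish outside \<open>X\<close>,
  with pointwise operations, so that it is a linear subspace of the complex vector space of
  all functions; its dimension and that of its subspaces is \<open>cfun.dim\<close>.
\<close>

definition cscale :: "complex \<Rightarrow> ('i \<Rightarrow> complex) \<Rightarrow> 'i \<Rightarrow> complex" where
  "cscale c v = (\<lambda>x. c * v x)"

interpretation cfun: vector_space "cscale :: complex \<Rightarrow> ('i \<Rightarrow> complex) \<Rightarrow> 'i \<Rightarrow> complex"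
  by standard (auto simp: cscale_def fun_eq_iff algebra_simps)

definition cvecs :: "'i set \<Rightarrow> ('i \<Rightarrow> complex) set" where
  "cvecs X = {v. \<forall>x. x \<notin> X \<longrightarrow> v x = 0}"

definition mat_vec ::
  "'i set \<Rightarrow> ('i \<Rightarrow> 'i \<Rightarrow> complex) \<Rightarrow> ('i \<Rightarrow> complex) \<Rightarrow> 'i \<Rightarrow> complex" where
  "mat_vec X M v = (\<lambda>y. if y \<in> X then \<Sum>z\<in>X. M y z * v z else 0)"

definition eigenspace ::
  "'i set \<Rightarrow> ('i \<Rightarrow> 'i \<Rightarrow> complex) \<Rightarrow> complex \<Rightarrow> ('i \<Rightarrow> complex) set" where
  "eigenspace X M c = {v \<in> cvecs X. mat_vec X M v = cscale c v}"

definition eigenvalue :: "'i set \<Rightarrow> ('i \<Rightarrow> 'i \<Rightarrow> complex) \<Rightarrow> complex \<Rightarrow> bool" where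
  "eigenvalue X M c \<longleftrightarrow> (\<exists>v \<in> eigenspace X M c. v \<noteq> 0)"


section \<open>The projective geometry and the matrix \<open>A\<close>\<close>

definition subspaces ::
  "('k::field \<Rightarrow> 'v::ab_group_add \<Rightarrow> 'v) \<Rightarrow> 'v set set" where
  "subspaces scale = {y. module.subspace scale y}"

definition covers ::
  "('k::field \<Rightarrow> 'v::ab_group_add \<Rightarrow> 'v) \<Rightarrow> 'v set \<Rightarrow> 'v set \<Rightarrow> bool" where
  "covers scale y z \<longleftrightarrow>
     z \<subseteq> y \<and> int (vector_space.dim scale y) - int (vector_space.dim scale z) = 1"

definition A_mat ::
  "('k::field \<Rightarrow> 'v::ab_group_add \<Rightarrow> 'v) \<Rightarrow> nat \<Rightarrow> real \<Rightarrow> 'v set \<Rightarrow> 'v set \<Rightarrow> complex" where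
  "A_mat scale q \<phi> y z = complex_of_real
     (if covers scale y z then 1
      else if covers scale z y then \<phi> * real q ^ vector_space.dim scale y
      else if y = z then (\<phi> - 1) / (real q - 1) * real q ^ vector_space.dim scale y
      else 0)"

definition theta :: "nat \<Rightarrow> real \<Rightarrow> nat \<Rightarrow> nat \<Rightarrow> real" where
  "theta q \<phi> N i = (\<phi> * real q ^ (N - i) - real q ^ i) / (real q - 1)"


section \<open>Gaussian binomial coefficients\<close>

definition q_num :: "nat \<Rightarrow> nat \<Rightarrow> real" where
  "q_num q n = (real q ^ n - 1) / (real q - 1)"

definition q_fact :: "nat \<Rightarrow> nat \<Rightarrow> real" where
  "q_fact q n = (\<Prod>k=1..n. q_num q k)"

definition q_binom :: "nat \<Rightarrow> nat \<Rightarrow> nat \<Rightarrow> real" where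
  "q_binom q n i = q_fact q n / (q_fact q i * q_fact q (n - i))"

end

theory Submission
  imports Defs
begin

text \<open>
  For a subspace \<open>W\<close> put \<open>e\<^sub>W(y) = q\<^bsup>-dim W dim y\<^esup>\<close> if \<open>W \<subseteq> y\<close> and \<open>0\<close> otherwise. Then
  \<open>A e\<^sub>W = \<theta>\<^bsub>dim W\<^esub> e\<^sub>W + \<phi> q\<^bsup>-dim W\<^esup> \<Sum> e\<^sub>U\<close>, the sum being over the hyperplanes \<open>U\<close> of \<open>W\<close>.
  The \<open>e\<^sub>W\<close> form a basis of \<open>\<complex>\<^sup>X\<close>, so \<open>A\<close> is triangular in it; since the \<open>\<theta>\<^sub>i\<close> are distinct
  and the number of covers of \<open>U\<close> inside \<open>W\<close> depends only on the dimensions, each \<open>e\<^sub>W\<close>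
  can be corrected by explicit multiples of the \<open>e\<^sub>U\<close> with \<open>U \<subset> W\<close> to an eigenvector for \<open>\<theta>\<^bsub>dim W\<^esub>\<close>.
  This gives an eigenbasis indexed by \<open>X\<close>, and there are \<open>q_binom q N i\<close> subspaces of dimension \<open>i\<close>.
\<close>

section \<open>Eigenbases\<close>

lemma sum_fun_apply: "(\<Sum>j\<in>J. F j) x = (\<Sum>j\<in>J. F j x)"
  by (induction J rule: infinite_finite_induct) auto

text \<open>The space \<open>cvecs X\<close> has dimension \<open>card X\<close>, so that many
  independent vectors form a basis. Independence is assumed for the indexed family: a coincidence
  \<open>F i = F j\<close> would be a nontrivial relation, which makes \<open>F\<close>
  injective.\<close>

lemma finite_eigenbasis_span:
  fixes F :: "'j \<Rightarrow> 'i \<Rightarrow> complex"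
  assumes fin: "finite X" "finite J" and card: "card J = card X"
    and F: "\<And>j. j \<in> J \<Longrightarrow> F j \<in> cvecs X"
    and indep: "\<And>c. (\<Sum>j\<in>J. cscale (c j) (F j)) = 0 \<Longrightarrow> \<forall>j\<in>J. c j = 0"
  shows "inj_on F J" "cfun.independent (F ` J)" "cvecs X \<subseteq> cfun.span (F ` J)"
proof -
  show inj: "inj_on F J"
  proof (rule inj_onI, rule ccontr)
    fix i j assume ij: "i \<in> J" "j \<in> J" "F i = F j" "i \<noteq> j"
    let ?c = "\<lambda>k. if k = i then 1 else if k = j then -1 else 0 :: complex"
    have "(\<Sum>k\<in>J. cscale (?c k) (F k)) = (\<Sum>k\<in>{i, j}. cscale (?c k) (F k))"
      using ij fin by (intro sum.mono_neutral_right) (auto simp: cscale_def fun_eq_iff)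
    also have "\<dots> = 0"
      using ij by (simp add: cscale_def fun_eq_iff)
    finally show False using indep[of ?c] ij by auto
  qed
  show *: "cfun.independent (F ` J)"
  proof (rule cfun.independent_if_scalars_zero)
    fix g v assume g: "(\<Sum>x\<in>F ` J. cscale (g x) x) = 0" and "v \<in> F ` J"
    then obtain j where "v = F j" "j \<in> J" by auto
    moreover have "(\<Sum>j\<in>J. cscale ((g \<circ> F) j) (F j)) = 0"
      using g inj by (simp add: sum.reindex)
    ultimately show "g v = 0"
      using indep[of "g \<circ> F"] by auto
  qed (use fin in simp)
  show "cvecs X \<subseteq> cfun.span (F ` J)"
  proof (rule subsetI, rule ccontr)
    fix v assume v: "v \<in> cvecs X" "v \<notin> cfun.span (F ` J)"
    \<comment> \<open>The unit vectors span \<open>cvecs X\<close>; a vector outside the span of the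
      family would give more than \<open>card X\<close> independent vectors in there.\<close>
    define d :: "'i \<Rightarrow> 'i \<Rightarrow> complex" where "d = (\<lambda>x y. if y = x then 1 else 0)"
    have d: "cvecs X \<subseteq> cfun.span (d ` X)"
    proof
      fix u :: "'i \<Rightarrow> complex" assume "u \<in> cvecs X"
      then have "u = (\<Sum>x\<in>X. cscale (u x) (d x))"
        using fin by (auto simp: fun_eq_iff cvecs_def cscale_def d_def sum_fun_apply if_distrib cong: if_cong)
      moreover have "(\<Sum>x\<in>X. cscale (u x) (d x)) \<in> cfun.span (d ` X)"
        by (intro cfun.span_sum cfun.span_scale cfun.span_base) auto
      ultimately show "u \<in> cfun.span (d ` X)" by simp
    qed
    have "card (insert v (F ` J)) \<le> card (d ` X)"
    proof (rule conjunct2[OF cfun.independent_span_bound])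
      show "cfun.independent (insert v (F ` J))"
        using v(2) * by (rule cfun.independent_insertI)
      show "insert v (F ` J) \<subseteq> cfun.span (d ` X)" using v(1) F d by blast
    qed (use fin in simp)
    also have "\<dots> \<le> card J" using fin card card_image_le by metis
    finally show False
      using v(2) fin card_image[OF inj] cfun.span_base[of v "F ` J"]
      by (auto simp: card_insert_if split: if_splits)
  qed
qed

lemma mat_vec_sum:
  "mat_vec X M (\<Sum>j\<in>J. cscale (c j) (F j)) = (\<Sum>j\<in>J. cscale (c j) (mat_vec X M (F j)))"
proof
  fix y
  have "(\<Sum>z\<in>X. M y z * (\<Sum>j\<in>J. c j * F j z)) = (\<Sum>j\<in>J. c j * (\<Sum>z\<in>X. M y z * F j z))"
    by (simp add: sum_distrib_left sum.swap[of _ J X] mult.left_commute)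
  then show "mat_vec X M (\<Sum>j\<in>J. cscale (c j) (F j)) y = (\<Sum>j\<in>J. cscale (c j) (mat_vec X M (F j))) y"
    by (simp add: mat_vec_def cscale_def sum_fun_apply)
qed

text \<open>Comparing coefficients in the basis shows that an eigenvector for \<open>\<nu>\<close>
  involves only those \<open>F j\<close> with \<open>\<mu> j = \<nu>\<close>. Values of
  \<open>\<mu>\<close> may repeat, and the repetitions are the dimensions.\<close>

lemma finite_eigenbasis:
  fixes F :: "'j \<Rightarrow> 'i \<Rightarrow> complex"
  assumes fin: "finite X" "finite J" and card: "card J = card X"
    and F: "\<And>j. j \<in> J \<Longrightarrow> F j \<in> eigenspace X M (\<mu> j)"
    and indep: "\<And>c. (\<Sum>j\<in>J. cscale (c j) (F j)) = 0 \<Longrightarrow> \<forall>j\<in>J. c j = 0"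
  shows "{c. eigenvalue X M c} = \<mu> ` J"
    and "cfun.dim (eigenspace X M \<nu>) = card {j \<in> J. \<mu> j = \<nu>}"
proof -
  have FX: "F j \<in> cvecs X" if "j \<in> J" for j
    using F[OF that] by (simp add: eigenspace_def)
  have basis: "inj_on F J" "cfun.independent (F ` J)" "cvecs X \<subseteq> cfun.span (F ` J)"
    by (rule finite_eigenbasis_span[where F = F, OF fin card], rule FX, assumption, rule indep, assumption)+
  have sub: "eigenspace X M \<nu> \<subseteq> cfun.span (F ` {j \<in> J. \<mu> j = \<nu>})" for \<nu>
  proof
    fix v assume v: "v \<in> eigenspace X M \<nu>"
    then have "v \<in> cfun.span (F ` J)" using basis(3) by (auto simp: eigenspace_def)
    then obtain g where "v = (\<Sum>x\<in>F ` J. cscale (g x) x)"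
      using fin by (auto simp: cfun.span_finite)
    then obtain c where c: "v = (\<Sum>j\<in>J. cscale (c j) (F j))"
      using basis(1) by (auto simp: sum.reindex)
    \<comment> \<open>This is \<open>M - \<nu>\<close> applied to the expansion of
      \<open>v\<close>.\<close>
    have "(\<Sum>j\<in>J. cscale (c j * (\<mu> j - \<nu>)) (F j)) =
        (\<Sum>j\<in>J. cscale (c j) (mat_vec X M (F j))) - cscale \<nu> v"
      unfolding c cfun.scale_sum_right sum_subtractf[symmetric] using F
      by (intro sum.cong) (auto simp: eigenspace_def cscale_def fun_eq_iff algebra_simps)
    also have "\<dots> = 0"
      using v by (simp add: c eigenspace_def flip: mat_vec_sum)
    finally have "c j * (\<mu> j - \<nu>) = 0" if "j \<in> J" for j
      using indep[of "\<lambda>j. c j * (\<mu> j - \<nu>)"] that by blast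
    then have "v = (\<Sum>j\<in>{j \<in> J. \<mu> j = \<nu>}. cscale (c j) (F j))"
      unfolding c using fin by (intro sum.mono_neutral_right) (auto simp: cscale_def fun_eq_iff)
    also have "\<dots> \<in> cfun.span (F ` {j \<in> J. \<mu> j = \<nu>})"
      by (intro cfun.span_sum cfun.span_scale cfun.span_base) auto
    finally show "v \<in> cfun.span (F ` {j \<in> J. \<mu> j = \<nu>})" .
  qed
  show "cfun.dim (eigenspace X M \<nu>) = card {j \<in> J. \<mu> j = \<nu>}"
  proof (rule cfun.dim_unique)
    show "F ` {j \<in> J. \<mu> j = \<nu>} \<subseteq> eigenspace X M \<nu>" using F by auto
    show "cfun.independent (F ` {j \<in> J. \<mu> j = \<nu>})"
      by (rule cfun.independent_mono[OF basis(2)]) auto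
    show "card (F ` {j \<in> J. \<mu> j = \<nu>}) = card {j \<in> J. \<mu> j = \<nu>}"
      by (intro card_image inj_on_subset[OF basis(1)]) auto
  qed (rule sub)
  show "{c. eigenvalue X M c} = \<mu> ` J"
  proof (intro set_eqI iffI)
    fix c assume "c \<in> {c. eigenvalue X M c}"
    then obtain v where v: "v \<in> eigenspace X M c" "v \<noteq> 0" by (auto simp: eigenvalue_def)
    show "c \<in> \<mu> ` J"
    proof (rule ccontr)
      assume "c \<notin> \<mu> ` J"
      then have *: "{j \<in> J. \<mu> j = c} = {}" by auto
      have "v \<in> cfun.span {}" by (rule subsetD[OF sub[of c, unfolded * image_empty] v(1)])
      with v(2) show False by (simp only: cfun.span_empty singleton_iff)
    qed
  next
    fix c assume "c \<in> \<mu> ` J"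
    then obtain j where j: "j \<in> J" "c = \<mu> j" by auto
    have "F j \<noteq> 0"
    proof
      assume "F j = 0"
      with j(1) have "0 \<in> F ` J" by (metis imageI)
      with cfun.dependent_zero basis(2) show False by blast
    qed
    with F[OF j(1)] show "c \<in> {c. eigenvalue X M c}"
      unfolding j(2) eigenvalue_def mem_Collect_eq by blast
  qed
qed

section \<open>Gaussian binomial coefficients and the eigenvalues\<close>

lemma q_num_pos: "2 \<le> q \<Longrightarrow> 0 < n \<Longrightarrow> 0 < q_num q n"
  by (simp add: q_num_def)

lemma q_num_0 [simp]: "q_num q 0 = 0"
  by (simp add: q_num_def)

lemma q_fact_Suc: "q_fact q (Suc n) = q_num q (Suc n) * q_fact q n"
  by (simp add: q_fact_def mult.commute)

lemma q_fact_pos: "2 \<le> q \<Longrightarrow> 0 < q_fact q n"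
  unfolding q_fact_def by (intro prod_pos) (simp add: q_num_pos)

lemma q_binom_0: "2 \<le> q \<Longrightarrow> q_binom q n 0 = 1"
  using q_fact_pos[of q n] q_fact_pos[of q 0] by (simp add: q_binom_def) (simp add: q_fact_def)

text \<open>The absorption identity, in the form in which the double count of subspaces produces
  it.\<close>

lemma q_binom_Suc_Suc:
  assumes "2 \<le> q"
  shows "q_num q (Suc j) * q_binom q (Suc n) (Suc j) = q_num q (Suc n) * q_binom q n j"
  using q_num_pos[OF assms, of "Suc j"] by (simp add: q_binom_def q_fact_Suc field_simps)

lemma q_binom_1:
  assumes "2 \<le> q" "0 < n"
  shows "q_binom q n 1 = q_num q n"
proof -
  obtain m where "n = Suc m" using assms(2) gr0_conv_Suc by auto
  then show ?thesis
    using q_binom_Suc_Suc[OF assms(1), of 0 m] assms(1)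
    by (simp add: q_binom_0) (simp add: q_num_def)
qed

lemma q_binom_pred:
  assumes "2 \<le> q" "0 < n"
  shows "q_binom q n (n - 1) = q_num q n"
  using q_binom_1[OF assms] assms(2) by (simp add: q_binom_def mult.commute)

text \<open>For \<open>q\<close> the size of the field, this is the number of vectors of an
  \<open>(m + n)\<close>-dimensional space outside an \<open>m\<close>-dimensional subspace.\<close>

lemma power_diff_eq_q_num:
  assumes "2 \<le> q"
  shows "real q ^ (m + n) - real q ^ m = (real q - 1) * real q ^ m * q_num q n"
  using assms by (simp add: q_num_def power_add field_simps)

text \<open>As the index grows, the term with \<open>\<phi>\<close> decreases and the subtracted
  power increases. This yields both the distinctness of the eigenvalues and the nonzero denominators
  in \<open>eig_coeff\<close>.\<close>

lemma theta_less:
  assumes "2 \<le> q" "0 < \<phi>" "i < j" "j \<le> N"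
  shows "theta q \<phi> N j < theta q \<phi> N i"
proof -
  have "real q ^ i < real q ^ j" using assms by simp
  moreover have "\<phi> * real q ^ (N - j) < \<phi> * real q ^ (N - i)" using assms by simp
  ultimately have "\<phi> * real q ^ (N - j) - real q ^ j < \<phi> * real q ^ (N - i) - real q ^ i"
    by linarith
  then show ?thesis
    using assms(1) unfolding theta_def by (intro divide_strict_right_mono) simp_all
qed

lemma theta_eq_iff:
  assumes "2 \<le> q" "0 < \<phi>" "i \<le> N" "j \<le> N"
  shows "theta q \<phi> N i = theta q \<phi> N j \<longleftrightarrow> i = j"
  using theta_less[OF assms(1,2), of i j N] theta_less[OF assms(1,2), of j i N] assms(3,4)
  by (cases i j rule: linorder_cases) auto

text \<open>
  The coordinates of the eigenvectors with respect to the vectors \<open>zeta\<close> below (the \<open>e\<^sub>W\<close> of the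
  introduction); the formula solves the recursion \<open>eig_coeff_rec\<close>.
\<close>

definition eig_coeff :: "nat \<Rightarrow> real \<Rightarrow> nat \<Rightarrow> nat \<Rightarrow> nat \<Rightarrow> real" where
  "eig_coeff q \<phi> N w u = (\<Prod>k=u..<w.
     \<phi> / real q ^ (k + 1) * q_num q (w - k) / (theta q \<phi> N w - theta q \<phi> N k))"

lemma eig_coeff_self: "eig_coeff q \<phi> N w w = 1"
  by (simp add: eig_coeff_def)

text \<open>States that \<open>zeta U\<close> with \<open>dim U = u\<close> has coefficient 0 in
  \<open>(A - theta_w) eig W\<close>, where \<open>dim W = w\<close>. For \<open>u < w\<close> the
  factor \<open>k = u\<close> of the product splits off; for \<open>u = w\<close> both sides are
  0.\<close>

lemma eig_coeff_rec:
  assumes "2 \<le> q" "0 < \<phi>" "u \<le> w" "w \<le> N"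
  shows "(theta q \<phi> N w - theta q \<phi> N u) * eig_coeff q \<phi> N w u =
    \<phi> / real q ^ (u + 1) * q_num q (w - u) * eig_coeff q \<phi> N w (u + 1)"
proof (cases "u = w")
  case False
  with assms have "u < w" by simp
  then have "theta q \<phi> N w - theta q \<phi> N u \<noteq> 0"
    using theta_less[OF assms(1,2), of u w N] assms by simp
  with \<open>u < w\<close> show ?thesis
    by (simp add: eig_coeff_def prod.atLeast_Suc_lessThan)
qed simp

section \<open>Counting subspaces\<close>

locale finite_projective_geometry =
  finite_dimensional_vector_space scale Basis
  for scale :: "'k::{field,finite} \<Rightarrow> 'v::ab_group_add \<Rightarrow> 'v" and Basis +
  fixes q :: nat
  assumes card_field: "CARD('k) = q"
begin

section \<open>Sizes of spans and subspaces\<close>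

lemma q_ge_2: "2 \<le> q"
proof -
  have "card {0, 1 :: 'k} \<le> CARD('k)" by (intro card_mono) auto
  then show ?thesis by (simp add: card_field)
qed

text \<open>Adjoining \<open>b\<close> multiplies the size by \<open>q\<close>, since
  \<open>(k, x)\<close> corresponds bijectively to \<open>k b + x\<close> with \<open>x\<close> in
  the old span.\<close>

lemma card_span_independent:
  assumes "finite B" "independent B"
  shows "finite (span B) \<and> card (span B) = q ^ card B"
  using assms
proof (induction B rule: finite_induct)
  case empty
  then show ?case by simp
next
  case (insert b B)
  have b: "b \<notin> span B" and B: "independent B"
    using insert by (auto simp: independent_insert)
  let ?h = "\<lambda>(k, x). scale k b + x"
  have inj: "inj_on ?h (UNIV \<times> span B)"
  proof (rule inj_onI, clarify)
    fix k x l y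
    assume *: "x \<in> span B" "y \<in> span B" "scale k b + x = scale l b + y"
    then have "scale (k - l) b = y - x" by (simp add: algebra_simps)
    with * have "scale (k - l) b \<in> span B" by (simp add: span_diff)
    \<comment> \<open>If \<open>k\<close> and \<open>l\<close> differed, dividing by
      \<open>k - l\<close> would put \<open>b\<close> into the span of \<open>B\<close>.\<close>
    then have "scale (inverse (k - l)) (scale (k - l) b) \<in> span B" by (rule span_scale)
    with b have "k = l" by (cases "k = l") auto
    with * show "k = l \<and> x = y" by simp
  qed
  have "span (insert b B) = ?h ` (UNIV \<times> span B)"
  proof (intro set_eqI iffI)
    fix x assume "x \<in> span (insert b B)"
    then obtain k where "x - scale k b \<in> span B" by (auto simp: span_insert)
    then show "x \<in> ?h ` (UNIV \<times> span B)"
      by (intro image_eqI[of _ _ "(k, x - scale k b)"]) auto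
  next
    fix x assume "x \<in> ?h ` (UNIV \<times> span B)"
    then obtain k y where "x = scale k b + y" "y \<in> span B" by auto
    then have "x - scale k b \<in> span B" by simp
    then show "x \<in> span (insert b B)" by (auto simp: span_insert)
  qed
  with inj insert.IH[OF B] insert.hyps show ?case
    by (simp add: card_image card_cartesian_product card_field)
qed

lemma finite_carrier: "finite (UNIV :: 'v set)"
  using card_span_independent[OF finite_Basis independent_Basis] by (simp add: span_Basis)

lemma finite_set [simp]: "finite (S :: 'v set)"
  using finite_carrier by (rule rev_finite_subset) simp

lemma finite_sets [simp]: "finite (S :: 'v set set)"
proof -
  have "finite (Pow (UNIV :: 'v set))" by (simp only: finite_Pow_iff finite_set)
  then show ?thesis by (rule rev_finite_subset) auto
qed

lemma card_subspace:
  assumes "subspace S"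
  shows "card S = q ^ dim S"
proof -
  obtain B where "B \<subseteq> S" "independent B" "S \<subseteq> span B" "card B = dim S"
    using basis_exists by blast
  then show ?thesis
    using card_span_independent[of B] assms by (metis finite_set span_minimal subset_antisym)
qed

lemma dim_subspace_eq:
  "subspace S \<Longrightarrow> subspace T \<Longrightarrow> S \<subseteq> T \<Longrightarrow> dim S = dim T \<Longrightarrow> S = T"
  using subspace_dim_equal by simp

section \<open>Subspaces between two given ones\<close>

lemma card_Diff_subspaces:
  assumes "subspace U" "subspace Z" "U \<subseteq> Z" "dim Z = dim U + k"
  shows "real (card (Z - U)) = (real q - 1) * real q ^ dim U * q_num q k"
proof -
  have "real (card (Z - U)) = real (card Z) - real (card U)"
    using assms(3) card_mono[OF finite_set assms(3)] by (simp only: card_Diff_subset finite_set of_nat_diff)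
  also have "\<dots> = real q ^ (dim U + k) - real q ^ dim U"
    using assms by (simp add: card_subspace)
  finally show ?thesis by (simp only: power_diff_eq_q_num[OF q_ge_2])
qed

text \<open>The inductive step counts the pairs \<open>(Z, v)\<close> with \<open>v \<in> Z - U\<close> in two ways.\<close>

lemma card_intermediate_subspaces:
  assumes "subspace U" "subspace W" "U \<subseteq> W" "dim U + j \<le> dim W"
  shows "real (card {Z. subspace Z \<and> U \<subseteq> Z \<and> Z \<subseteq> W \<and> dim Z = dim U + j})
    = q_binom q (dim W - dim U) j"
  using assms
proof (induction j arbitrary: U)
  case 0
  have "{Z. subspace Z \<and> U \<subseteq> Z \<and> Z \<subseteq> W \<and> dim Z = dim U + 0} = {U}" (is "?I = _")
  proof (rule equalityI; rule subsetI)
    fix Z assume "Z \<in> ?I"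
    then have "U = Z" by (intro dim_subspace_eq[OF 0(1)]) simp_all
    then show "Z \<in> {U}" by simp
  qed (use 0 in simp)
  then show ?case by (simp add: q_binom_0 q_ge_2)
next
  case (Suc j)
  let ?I = "{Z. subspace Z \<and> U \<subseteq> Z \<and> Z \<subseteq> W \<and> dim Z = dim U + Suc j}"
  obtain n where n: "dim W = dim U + Suc n" "j \<le> n"
    using Suc.prems(4) that[of "dim W - dim U - 1"] by simp
  \<comment> \<open>For fixed \<open>v\<close>, the spaces \<open>Z\<close> are those above the span
    of \<open>U\<close> and \<open>v\<close>, which has dimension \<open>dim U + 1\<close>; so the
    induction hypothesis is applied with a larger \<open>U\<close>.\<close>
  have *: "real (card {Z \<in> ?I. v \<in> Z}) = q_binom q n j" if v: "v \<in> W - U" for v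
  proof -
    let ?U = "span (insert v U)"
    have d: "dim ?U = Suc (dim U)"
      using v Suc.prems(1) by (simp add: dim_insert span_eq_iff[THEN iffD2])
    have "?U \<subseteq> Z \<longleftrightarrow> v \<in> Z \<and> U \<subseteq> Z" if "subspace Z" for Z
      using span_minimal[of "insert v U" Z] span_superset[of "insert v U"] that by blast
    then have "{Z \<in> ?I. v \<in> Z} = {Z. subspace Z \<and> ?U \<subseteq> Z \<and> Z \<subseteq> W \<and> dim Z = dim ?U + j}"
      unfolding d by auto
    moreover have "?U \<subseteq> W" using v Suc.prems by (simp add: span_minimal)
    ultimately show ?thesis
      using Suc.IH[of ?U] Suc.prems d n by simp
  qed
  have "real (card ?I) * ((real q - 1) * real q ^ dim U * q_num q (Suc j)) = (\<Sum>Z\<in>?I. real (card (Z - U)))"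
    using card_Diff_subspaces[OF Suc.prems(1)] by simp
  also have "\<dots> = (\<Sum>Z\<in>?I. real (card {v \<in> W - U. v \<in> Z}))"
    by (intro sum.cong refl arg_cong[where f = "\<lambda>x. real (card x)"]) auto
  also have "\<dots> = (\<Sum>v\<in>W - U. real (card {Z \<in> ?I. v \<in> Z}))"
    using sum_multicount_gen[of ?I "W - U" "\<lambda>Z v. v \<in> Z"]
    by (simp flip: of_nat_sum)
  also have "\<dots> = real (card (W - U)) * q_binom q n j"
    using * by simp
  also have "real (card (W - U)) = (real q - 1) * real q ^ dim U * q_num q (Suc n)"
    using card_Diff_subspaces[OF Suc.prems(1-3)] n by simp
  \<comment> \<open>Both counts carry the factor \<open>(q - 1) q^dim U\<close>, which
    cancels.\<close>
  finally have "real (card ?I) * q_num q (Suc j) = q_num q (Suc n) * q_binom q n j"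
    using q_ge_2 by simp
  then have "q_num q (Suc j) * real (card ?I) = q_num q (Suc j) * q_binom q (Suc n) (Suc j)"
    using q_binom_Suc_Suc[OF q_ge_2, of j n] by (simp only: mult.commute)
  then have "real (card ?I) = q_binom q (Suc n) (Suc j)"
    using q_num_pos[OF q_ge_2, of "Suc j"] by simp
  then show ?case using n by simp
qed

lemma card_subspaces_of_dim:
  assumes "j \<le> dim UNIV"
  shows "real (card {Z. subspace Z \<and> dim Z = j}) = q_binom q (dim UNIV) j"
proof -
  have "{Z. subspace Z \<and> dim Z = j} = {Z. subspace Z \<and> {0} \<subseteq> Z \<and> Z \<subseteq> UNIV \<and> dim Z = dim {0} + j}"
    by (auto simp: subspace_0)
  then show ?thesis
    using card_intermediate_subspaces[OF subspace_single_0 subspace_UNIV, of j] assms by simp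
qed

text \<open>The case \<open>j = 1\<close> of the count of intermediate subspaces. If
  \<open>U = W\<close>, there are none and \<open>q_num q 0 = 0\<close>.\<close>

lemma card_upper_covers:
  assumes "subspace U" "subspace W" "U \<subseteq> W"
  shows "real (card {Z. subspace Z \<and> U \<subseteq> Z \<and> Z \<subseteq> W \<and> dim Z = dim U + 1})
    = q_num q (dim W - dim U)"
proof (cases "dim U < dim W")
  case True
  then have "dim U + 1 \<le> dim W" "0 < dim W - dim U" by simp_all
  then show ?thesis
    by (simp only: card_intermediate_subspaces[OF assms] q_binom_1[OF q_ge_2])
next
  case False
  then have "{Z. subspace Z \<and> U \<subseteq> Z \<and> Z \<subseteq> W \<and> dim Z = dim U + 1} = {}"
    by (auto dest: dim_subset)
  with False show ?thesis by simp
qed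

lemma card_lower_covers:
  assumes "subspace U" "subspace W" "U \<subseteq> W"
  shows "real (card {Z. subspace Z \<and> U \<subseteq> Z \<and> Z \<subseteq> W \<and> dim W = dim Z + 1})
    = q_num q (dim W - dim U)"
proof (cases "dim U < dim W")
  case True
  have "{Z. subspace Z \<and> U \<subseteq> Z \<and> Z \<subseteq> W \<and> dim W = dim Z + 1} =
      {Z. subspace Z \<and> U \<subseteq> Z \<and> Z \<subseteq> W \<and> dim Z = dim U + (dim W - dim U - 1)}"
    using True by (intro Collect_cong) auto
  moreover have "dim U + (dim W - dim U - 1) \<le> dim W" "0 < dim W - dim U" using True by simp_all
  ultimately show ?thesis
    by (simp only: card_intermediate_subspaces[OF assms] q_binom_pred[OF q_ge_2])
next
  case False
  then have "{Z. subspace Z \<and> U \<subseteq> Z \<and> Z \<subseteq> W \<and> dim W = dim Z + 1} = {}"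
    by (auto dest: dim_subset)
  with False show ?thesis by simp
qed

end

section \<open>The eigenvectors of \<open>A\<close>\<close>

locale weighted_projective_geometry =
  finite_projective_geometry scale Basis q
  for scale :: "'k::{field,finite} \<Rightarrow> 'v::ab_group_add \<Rightarrow> 'v" and Basis q +
  fixes \<phi> :: real
  assumes phi_pos: "0 < \<phi>"
begin

abbreviation N :: nat where "N \<equiv> dim (UNIV :: 'v set)"

abbreviation \<theta> :: "nat \<Rightarrow> real" where "\<theta> \<equiv> theta q \<phi> N"

section \<open>The real form of A and the triangular basis\<close>

definition A_real :: "'v set \<Rightarrow> 'v set \<Rightarrow> real" where
  "A_real y z =
     (if z \<subseteq> y \<and> dim y = dim z + 1 then 1
      else if y \<subseteq> z \<and> dim z = dim y + 1 then \<phi> * real q ^ dim y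
      else if y = z then (\<phi> - 1) / (real q - 1) * real q ^ dim y
      else 0)"

lemma A_mat_eq: "A_mat scale q \<phi> y z = complex_of_real (A_real y z)"
proof -
  have "covers scale a b \<longleftrightarrow> b \<subseteq> a \<and> dim a = dim b + 1" for a b
    by (auto simp: covers_def)
  then show ?thesis by (simp add: A_mat_def A_real_def)
qed

text \<open>A weighted zeta function of the subspace lattice. With \<open>w = dim W\<close> and
  \<open>n = dim y\<close>, the weight satisfies
  \<open>q^n q^(-w(n+1)) = q^(-w) q^(-(w-1)n)\<close>, which balances the terms of
  \<open>A_real_zeta\<close> when \<open>y\<close> does not contain \<open>W\<close>.\<close>

definition zeta :: "'v set \<Rightarrow> 'v set \<Rightarrow> real" where
  "zeta W y = (if W \<subseteq> y then 1 / real q ^ (dim W * dim y) else 0)"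

lemma dim_le_N: "dim S \<le> N"
  by (rule dim_subset) simp

text \<open>Each \<open>z\<close> on the left contains \<open>W + y\<close>, each \<open>U\<close>
  on the right lies in the intersection of \<open>W\<close> and \<open>y\<close>. By the dimension
  formula \<open>W + y\<close> exceeds \<open>y\<close> by as much as \<open>W\<close> exceeds the
  intersection. If this difference is 1, each set has exactly one member; if it is larger, both are
  empty.\<close>

lemma card_joint_covers:
  assumes "subspace W" "subspace y" "\<not> W \<subseteq> y"
  shows "card {z. subspace z \<and> W \<subseteq> z \<and> y \<subseteq> z \<and> dim z = dim y + 1} =
    card {U. subspace U \<and> U \<subseteq> W \<and> dim W = dim U + 1 \<and> U \<subseteq> y}"
    (is "card ?B = card ?C")
proof -
  define J where "J = {a + b |a b. a \<in> W \<and> b \<in> y}"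
  have J: "subspace J" unfolding J_def by (rule subspace_sums) fact+
  have I: "subspace (W \<inter> y)" by (rule subspace_inter) fact+
  have dims: "dim J + dim (W \<inter> y) = dim W + dim y"
    unfolding J_def by (rule dim_sums_Int) fact+
  have less: "dim (W \<inter> y) < dim W"
  proof (rule ccontr)
    assume "\<not> dim (W \<inter> y) < dim W"
    then have "W \<inter> y = W" using I assms(1) by (intro subspace_dim_equal) auto
    with assms(3) show False by auto
  qed
  have "W \<subseteq> J"
  proof
    fix a assume "a \<in> W"
    then have "a = a + 0 \<and> a \<in> W \<and> 0 \<in> y" using subspace_0[OF assms(2)] by simp
    then show "a \<in> J" unfolding J_def by blast
  qed
  moreover have "y \<subseteq> J"
  proof
    fix b assume "b \<in> y"
    then have "b = 0 + b \<and> 0 \<in> W \<and> b \<in> y" using subspace_0[OF assms(1)] by simp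
    then show "b \<in> J" unfolding J_def by blast
  qed
  moreover have "J \<subseteq> z" if "subspace z" "W \<subseteq> z" "y \<subseteq> z" for z
    using that subspace_add[OF that(1)] unfolding J_def by blast
  ultimately have B: "?B = {z. subspace z \<and> J \<subseteq> z \<and> dim z = dim y + 1}" by blast
  have C: "?C = {U. subspace U \<and> U \<subseteq> W \<inter> y \<and> dim W = dim U + 1}" by blast
  show ?thesis
  proof (cases "dim W = dim (W \<inter> y) + 1")
    case True
    then have "dim J = dim y + 1" using dims by simp
    then have "z \<in> ?B \<longleftrightarrow> z = J" for z
      unfolding B mem_Collect_eq using J dim_subspace_eq[OF J, of z] by auto
    then have "?B = {J}" by blast
    moreover have "U \<in> ?C \<longleftrightarrow> U = W \<inter> y" for U
      unfolding C mem_Collect_eq using I True dim_subspace_eq[OF _ I, of U] by auto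
    then have "?C = {W \<inter> y}" by blast
    ultimately show ?thesis by simp
  next
    case False
    have "dim J > dim y + 1" using dims less False by linarith
    then have "dim z \<noteq> dim y + 1" if "J \<subseteq> z" for z
      using dim_subset[OF that] by linarith
    then have "?B = {}" unfolding B by blast
    moreover have "dim W \<noteq> dim U + 1" if "U \<subseteq> W \<inter> y" for U
      using dim_subset[OF that] less False by linarith
    then have "?C = {}" unfolding C by blast
    ultimately show ?thesis by (simp only: card.empty)
  qed
qed

section \<open>Action of A on the triangular basis\<close>

lemma sum_A_real:
  assumes "subspace y"
  shows "(\<Sum>z | subspace z. A_real y z * g z) =
    (\<Sum>z | subspace z \<and> z \<subseteq> y \<and> dim y = dim z + 1. g z) +
    \<phi> * real q ^ dim y * (\<Sum>z | subspace z \<and> y \<subseteq> z \<and> dim z = dim y + 1. g z) +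
    (\<phi> - 1) / (real q - 1) * real q ^ dim y * g y"
proof -
  let ?d = "(\<phi> - 1) / (real q - 1) * real q ^ dim y"
  have "A_real y z * g z = (if z \<subseteq> y \<and> dim y = dim z + 1 then g z else 0) +
      (if y \<subseteq> z \<and> dim z = dim y + 1 then \<phi> * real q ^ dim y * g z else 0) +
      (if z = y then ?d * g y else 0)" for z
    by (auto simp: A_real_def)
  then have "(\<Sum>z | subspace z. A_real y z * g z) =
      (\<Sum>z | subspace z. if z \<subseteq> y \<and> dim y = dim z + 1 then g z else 0) +
      (\<Sum>z | subspace z. if y \<subseteq> z \<and> dim z = dim y + 1 then \<phi> * real q ^ dim y * g z else 0) +
      (\<Sum>z | subspace z. if z = y then ?d * g y else 0)"
    by (simp only: sum.distrib)
  moreover have "(\<Sum>z | subspace z. if z = y then ?d * g y else 0) = ?d * g y"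
    using assms by simp
  ultimately show ?thesis
    by (simp only: sum.inter_filter[OF finite_sets, symmetric] mem_Collect_eq sum_distrib_left)
qed

text \<open>At a fixed \<open>y\<close> all sums reduce to counts of covers. If \<open>W\<close>
  lies in \<open>y\<close>, the counts are q-numbers and an identity in \<open>q\<close> remains.
  Otherwise only covers of \<open>y\<close> contribute on the left, and
  \<open>card_joint_covers\<close> matches them with hyperplanes of \<open>W\<close>.\<close>

lemma A_real_zeta:
  assumes W: "subspace W" and y: "subspace y"
  shows "(\<Sum>z | subspace z. A_real y z * zeta W z) = \<theta> (dim W) * zeta W y +
    \<phi> / real q ^ dim W * (\<Sum>U | subspace U \<and> U \<subseteq> W \<and> dim W = dim U + 1. zeta U y)"
proof -
  let ?w = "dim W" and ?n = "dim y" and ?Q = "real q"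
  let ?C = "{U. subspace U \<and> U \<subseteq> W \<and> dim W = dim U + 1 \<and> U \<subseteq> y}"
  have Q: "?Q > 1" using q_ge_2 by simp
  have S1: "(\<Sum>z | subspace z \<and> z \<subseteq> y \<and> dim y = dim z + 1. zeta W z) =
      real (card {z. subspace z \<and> W \<subseteq> z \<and> z \<subseteq> y \<and> dim y = dim z + 1}) / ?Q ^ (?w * (?n - 1))"
  proof -
    have "(\<Sum>z | subspace z \<and> z \<subseteq> y \<and> dim y = dim z + 1. zeta W z) =
      (\<Sum>z | subspace z \<and> W \<subseteq> z \<and> z \<subseteq> y \<and> dim y = dim z + 1. 1 / ?Q ^ (?w * (?n - 1)))"
      by (rule sum.mono_neutral_cong_right) (auto simp: zeta_def)
    then show ?thesis by (simp only: sum_constant times_divide_eq_right mult_1_right)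
  qed
  have S2: "(\<Sum>z | subspace z \<and> y \<subseteq> z \<and> dim z = dim y + 1. zeta W z) =
      real (card {z. subspace z \<and> W \<subseteq> z \<and> y \<subseteq> z \<and> dim z = dim y + 1}) / ?Q ^ (?w * (?n + 1))"
  proof -
    have "(\<Sum>z | subspace z \<and> y \<subseteq> z \<and> dim z = dim y + 1. zeta W z) =
      (\<Sum>z | subspace z \<and> W \<subseteq> z \<and> y \<subseteq> z \<and> dim z = dim y + 1. 1 / ?Q ^ (?w * (?n + 1)))"
      by (rule sum.mono_neutral_cong_right) (auto simp: zeta_def)
    then show ?thesis by (simp only: sum_constant times_divide_eq_right mult_1_right)
  qed
  have S3: "(\<Sum>U | subspace U \<and> U \<subseteq> W \<and> dim W = dim U + 1. zeta U y) =
      real (card ?C) / ?Q ^ ((?w - 1) * ?n)"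
  proof -
    have "(\<Sum>U | subspace U \<and> U \<subseteq> W \<and> dim W = dim U + 1. zeta U y) =
      (\<Sum>U\<in>?C. 1 / ?Q ^ ((?w - 1) * ?n))"
      by (rule sum.mono_neutral_cong_right) (auto simp: zeta_def)
    then show ?thesis by (simp only: sum_constant times_divide_eq_right mult_1_right)
  qed
  show ?thesis
  proof (cases "W \<subseteq> y")
    case True
    obtain k where k: "?n = ?w + k" using dim_subset[OF True] le_Suc_ex by blast
    obtain l where l: "N = ?n + l" using dim_le_N le_Suc_ex by blast
    have c1: "real (card {z. subspace z \<and> W \<subseteq> z \<and> z \<subseteq> y \<and> dim y = dim z + 1}) = q_num q k"
      using card_lower_covers[OF W y True] k by simp
    have "real (card {z. subspace z \<and> y \<subseteq> z \<and> z \<subseteq> UNIV \<and> dim z = dim y + 1}) = q_num q l"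
      using card_upper_covers[OF y subspace_UNIV] l by (simp del: dim_UNIV)
    moreover have "{z. subspace z \<and> W \<subseteq> z \<and> y \<subseteq> z \<and> dim z = dim y + 1} =
        {z. subspace z \<and> y \<subseteq> z \<and> z \<subseteq> UNIV \<and> dim z = dim y + 1}"
      using True by auto
    ultimately have c2: "real (card {z. subspace z \<and> W \<subseteq> z \<and> y \<subseteq> z \<and> dim z = dim y + 1}) = q_num q l"
      by simp
    have "?C = {U. subspace U \<and> {0} \<subseteq> U \<and> U \<subseteq> W \<and> dim W = dim U + 1}"
      using True subspace_0 by auto
    then have c3: "real (card ?C) = q_num q ?w"
      using card_lower_covers[OF subspace_single_0 W] subspace_0[OF W] by simp
    \<comment> \<open>Truncation of \<open>?n - 1\<close> can occur only for \<open>k = 0\<close>,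
      where both sides are 0.\<close>
    have e1: "q_num q k / ?Q ^ (?w * (?n - 1)) = q_num q k * ?Q ^ ?w / ?Q ^ (?w * ?n)"
      using Q by (cases k) (simp_all add: k power_add field_simps)
    have e3: "q_num q ?w / ?Q ^ ((?w - 1) * ?n) = q_num q ?w * ?Q ^ ?n / ?Q ^ (?w * ?n)"
    proof (cases "?w = 0")
      case False
      then obtain v where "?w = Suc v" using not0_implies_Suc by blast
      with Q show ?thesis by (simp add: power_add field_simps)
    qed (simp only: q_num_0 div_0 mult_zero_left)
    have e2: "q_num q l / ?Q ^ (?w * (?n + 1)) = q_num q l / (?Q ^ ?w * ?Q ^ (?w * ?n))"
      by (simp add: power_add algebra_simps)
    \<comment> \<open>With the common weight removed, this is the identity that determines
      \<open>\<theta>\<close>: the powers of \<open>q\<close> with exponent \<open>N - dim W\<close>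
      come from the covers of \<open>y\<close>.\<close>
    have e: "q_num q k * ?Q ^ ?w + \<phi> * ?Q ^ ?n * q_num q l / ?Q ^ ?w + (\<phi> - 1) / (?Q - 1) * ?Q ^ ?n =
        \<theta> ?w + \<phi> / ?Q ^ ?w * q_num q ?w * ?Q ^ ?n"
    proof -
      have "N - ?w = k + l" using k l by simp
      then show ?thesis using Q
        unfolding q_num_def theta_def k
        by (simp add: power_add divide_simps) (simp add: algebra_simps)
    qed
    have "(q_num q k * ?Q ^ ?w + \<phi> * ?Q ^ ?n * q_num q l / ?Q ^ ?w + (\<phi> - 1) / (?Q - 1) * ?Q ^ ?n) / ?Q ^ (?w * ?n) =
        (\<theta> ?w + \<phi> / ?Q ^ ?w * q_num q ?w * ?Q ^ ?n) / ?Q ^ (?w * ?n)"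
      by (simp only: e)
    then show ?thesis
      unfolding sum_A_real[OF y] S1 S2 S3 c1 c2 c3 e1 e2 e3 using True
      by (simp add: zeta_def add_divide_distrib del: dim_UNIV)
  next
    case False
    then have c1: "{z. subspace z \<and> W \<subseteq> z \<and> z \<subseteq> y \<and> dim y = dim z + 1} = {}" by auto
    \<comment> \<open>The zero space lies in \<open>y\<close>, so \<open>W\<close> is nonzero and
      \<open>?w - 1\<close> is a true predecessor.\<close>
    have "?w \<noteq> 0" using False subspace_0[OF y] by auto
    then obtain v where v: "?w = Suc v" using not0_implies_Suc by blast
    show ?thesis
      unfolding sum_A_real[OF y] S1 S2 S3 c1 card_joint_covers[OF W y False]
      unfolding v
      using False Q by (simp add: zeta_def power_add field_simps)
  qed
qed

section \<open>The eigenvectors and their independence\<close>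

definition eig :: "'v set \<Rightarrow> 'v set \<Rightarrow> real" where
  "eig W y = (\<Sum>U | subspace U \<and> U \<subseteq> W. eig_coeff q \<phi> N (dim W) (dim U) * zeta U y)"

text \<open>Besides its diagonal term, \<open>zeta T\<close> receives one term from each
  \<open>U\<close> covering \<open>T\<close> inside \<open>W\<close>. There are
  \<open>q_num q (dim W - dim T)\<close> of these, and \<open>eig_coeff_rec\<close> says that
  together they turn the factor \<open>\<theta> (dim T)\<close> into
  \<open>\<theta> (dim W)\<close>.\<close>

lemma A_real_eig:
  assumes W: "subspace W" and y: "subspace y"
  shows "(\<Sum>z | subspace z. A_real y z * eig W z) = \<theta> (dim W) * eig W y"
proof -
  let ?S = "{U. subspace U \<and> U \<subseteq> W}" and ?a = "eig_coeff q \<phi> N (dim W)"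
  let ?R = "\<lambda>U T. T \<subseteq> U \<and> dim U = dim T + 1"
  have "(\<Sum>z | subspace z. A_real y z * eig W z) =
      (\<Sum>U\<in>?S. ?a (dim U) * (\<Sum>z | subspace z. A_real y z * zeta U z))"
    unfolding eig_def sum_distrib_left
    by (subst sum.swap) (simp add: mult.left_commute del: dim_UNIV)
  also have "\<dots> = (\<Sum>U\<in>?S. \<theta> (dim U) * ?a (dim U) * zeta U y) +
      (\<Sum>U\<in>?S. \<Sum>T | T \<in> ?S \<and> ?R U T. ?a (dim U) * (\<phi> / real q ^ dim U) * zeta T y)"
    unfolding sum.distrib[symmetric]
  proof (intro sum.cong refl)
    fix U assume U: "U \<in> ?S"
    then have *: "{T. T \<in> ?S \<and> ?R U T} = {T. subspace T \<and> T \<subseteq> U \<and> dim U = dim T + 1}" by auto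
    have "subspace U" using U by simp
    show "?a (dim U) * (\<Sum>z | subspace z. A_real y z * zeta U z) =
        \<theta> (dim U) * ?a (dim U) * zeta U y +
        (\<Sum>T | T \<in> ?S \<and> ?R U T. ?a (dim U) * (\<phi> / real q ^ dim U) * zeta T y)"
      unfolding A_real_zeta[OF \<open>subspace U\<close> y] *
      by (simp only: distrib_left sum_distrib_left mult_ac)
  qed
  \<comment> \<open>The pairs of a space and its hyperplane are regrouped by the hyperplane
    \<open>T\<close>.\<close>
  also have "(\<Sum>U\<in>?S. \<Sum>T | T \<in> ?S \<and> ?R U T. ?a (dim U) * (\<phi> / real q ^ dim U) * zeta T y) =
      (\<Sum>T\<in>?S. \<Sum>U | U \<in> ?S \<and> ?R U T. ?a (dim U) * (\<phi> / real q ^ dim U) * zeta T y)"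
    by (rule sum.swap_restrict) simp_all
  also have "\<dots> = (\<Sum>T\<in>?S. (\<theta> (dim W) - \<theta> (dim T)) * ?a (dim T) * zeta T y)"
  proof (intro sum.cong refl)
    fix T assume T: "T \<in> ?S"
    have "(\<Sum>U | U \<in> ?S \<and> ?R U T. ?a (dim U) * (\<phi> / real q ^ dim U) * zeta T y) =
        (\<Sum>U | subspace U \<and> T \<subseteq> U \<and> U \<subseteq> W \<and> dim U = dim T + 1.
          ?a (dim T + 1) * (\<phi> / real q ^ (dim T + 1)) * zeta T y)"
      by (intro sum.cong) auto
    also have "\<dots> = q_num q (dim W - dim T) * (?a (dim T + 1) * (\<phi> / real q ^ (dim T + 1)) * zeta T y)"
      using card_upper_covers[of T W] T W by simp
    also have "\<dots> = (\<theta> (dim W) - \<theta> (dim T)) * ?a (dim T) * zeta T y"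
      using eig_coeff_rec[OF q_ge_2 phi_pos _ dim_le_N, of "dim T" W] dim_subset[of T W] T
      by (simp add: mult_ac del: dim_UNIV)
    finally show "(\<Sum>U | U \<in> ?S \<and> ?R U T. ?a (dim U) * (\<phi> / real q ^ dim U) * zeta T y) =
        (\<theta> (dim W) - \<theta> (dim T)) * ?a (dim T) * zeta T y" .
  qed
  also have "(\<Sum>U\<in>?S. \<theta> (dim U) * ?a (dim U) * zeta U y) +
      (\<Sum>T\<in>?S. (\<theta> (dim W) - \<theta> (dim T)) * ?a (dim T) * zeta T y) = \<theta> (dim W) * eig W y"
    unfolding eig_def sum_distrib_left sum.distrib[symmetric]
    by (intro sum.cong refl) (simp add: algebra_simps del: dim_UNIV)
  finally show ?thesis .
qed

lemma dim_less:
  assumes "subspace U" "subspace W" "U \<subset> W"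
  shows "dim U < dim W"
  using assms dim_subspace_eq[of U W] dim_subset[of U W] by fastforce

text \<open>Triangularity: \<open>zeta U W\<close> vanishes unless \<open>U\<close> lies in
  \<open>W\<close>. Evaluating the relation at \<open>W\<close>, with smaller dimensions already
  settled, leaves only the nonzero diagonal term.\<close>

lemma zeta_independent:
  assumes c: "\<And>y. subspace y \<Longrightarrow> (\<Sum>W | subspace W. c W * complex_of_real (zeta W y)) = 0"
    and W: "subspace W"
  shows "c W = 0"
  using W
proof (induction "dim W" arbitrary: W rule: less_induct)
  case less
  have "c U * complex_of_real (zeta U W) = 0" if "U \<in> {U. subspace U} - {W}" for U
    using that less.hyps[of U] dim_less[of U W] less.prems by (cases "U \<subset> W") (auto simp: zeta_def)
  then have "(\<Sum>U\<in>{U. subspace U} - {W}. c U * complex_of_real (zeta U W)) = 0"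
    by (intro sum.neutral ballI)
  then have "(\<Sum>U | subspace U. c U * complex_of_real (zeta U W)) = c W * complex_of_real (zeta W W)"
    using less.prems by (simp add: sum.remove[of _ W])
  with c[OF less.prems] q_ge_2 show ?case by (simp add: zeta_def)
qed

text \<open>Rewritten in terms of \<open>zeta\<close>, the relation says that for each
  \<open>U\<close> the sum of \<open>c W\<close> times the coefficient of \<open>zeta U\<close> in
  \<open>eig W\<close>, over \<open>W\<close> containing \<open>U\<close>, is 0. This system is
  triangular with unit diagonal and is solved from the whole space downwards.\<close>

lemma eig_independent:
  assumes c: "\<And>y. subspace y \<Longrightarrow> (\<Sum>W | subspace W. c W * complex_of_real (eig W y)) = 0"
    and W: "subspace W"
  shows "c W = 0"
proof -
  let ?a = "\<lambda>W U. complex_of_real (eig_coeff q \<phi> N (dim W) (dim U))"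
  have *: "(\<Sum>W | W \<in> {W. subspace W} \<and> U \<subseteq> W. c W * ?a W U) = 0" if "subspace U" for U
  proof (rule zeta_independent[OF _ that])
    fix y :: "'v set" assume "subspace y"
    have "(\<Sum>U | subspace U. (\<Sum>W | W \<in> {W. subspace W} \<and> U \<subseteq> W. c W * ?a W U) * complex_of_real (zeta U y)) =
        (\<Sum>U | subspace U. \<Sum>W | W \<in> {W. subspace W} \<and> U \<subseteq> W. c W * ?a W U * complex_of_real (zeta U y))"
      by (simp only: sum_distrib_right)
    also have "\<dots> = (\<Sum>W | subspace W. \<Sum>U | U \<in> {U. subspace U} \<and> U \<subseteq> W. c W * ?a W U * complex_of_real (zeta U y))"
      by (rule sum.swap_restrict) simp_all
    also have "\<dots> = (\<Sum>W | subspace W. c W * complex_of_real (eig W y))"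
      by (simp add: eig_def sum_distrib_left mult.assoc del: dim_UNIV)
    also have "\<dots> = 0" by (rule c) fact
    finally show "(\<Sum>U | subspace U. (\<Sum>W | W \<in> {W. subspace W} \<and> U \<subseteq> W. c W * ?a W U) * complex_of_real (zeta U y)) = 0" .
  qed
  show ?thesis using W
  proof (induction "N - dim W" arbitrary: W rule: less_induct)
    case less
    have "c U * ?a U W = 0" if "U \<in> {U. U \<in> {U. subspace U} \<and> W \<subseteq> U} - {W}" for U
    proof -
      have "dim W < dim U" using that less.prems by (intro dim_less) auto
      then have "N - dim U < N - dim W" using dim_le_N[of U] by linarith
      with less.hyps that show ?thesis by simp
    qed
    then have "(\<Sum>U\<in>{U. U \<in> {U. subspace U} \<and> W \<subseteq> U} - {W}. c U * ?a U W) = 0"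
      by (intro sum.neutral ballI)
    then have "(\<Sum>U | U \<in> {U. subspace U} \<and> W \<subseteq> U. c U * ?a U W) = c W * ?a W W"
      using less.prems by (simp add: sum.remove[of _ W] del: dim_UNIV)
    with *[OF less.prems] show ?case by (simp add: eig_coeff_self del: dim_UNIV)
  qed
qed

text \<open>Extended by 0 to sets that are not subspaces, as membership in \<open>cvecs\<close>
  demands.\<close>

definition eigvec :: "'v set \<Rightarrow> 'v set \<Rightarrow> complex" where
  "eigvec W y = (if subspace y then complex_of_real (eig W y) else 0)"

lemma eigvec_eigenspace:
  assumes "subspace W"
  shows "eigvec W \<in> eigenspace (subspaces scale) (A_mat scale q \<phi>) (complex_of_real (\<theta> (dim W)))"
proof -
  have "(\<Sum>z | subspace z. A_mat scale q \<phi> y z * eigvec W z) =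
      complex_of_real (\<theta> (dim W)) * eigvec W y" if "subspace y" for y
    using A_real_eig[OF assms that, THEN arg_cong[of _ _ complex_of_real]] that
    by (simp add: eigvec_def A_mat_eq del: dim_UNIV)
  then show ?thesis
    by (auto simp: eigenspace_def cvecs_def mat_vec_def cscale_def subspaces_def eigvec_def fun_eq_iff
        simp del: dim_UNIV)
qed

lemma eigvec_independent:
  assumes "(\<Sum>W\<in>subspaces scale. cscale (c W) (eigvec W)) = 0"
  shows "\<forall>W\<in>subspaces scale. c W = 0"
proof
  fix W assume "W \<in> subspaces scale"
  then have "subspace W" by (simp add: subspaces_def)
  moreover have "(\<Sum>W | subspace W. c W * complex_of_real (eig W y)) = 0" if "subspace y" for y
    using fun_cong[OF assms, of y] that
    by (simp add: sum_fun_apply cscale_def eigvec_def subspaces_def)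
  ultimately show "c W = 0" by (rule eig_independent[rotated])
qed

lemma eigenvalues_A:
  "{c. eigenvalue (subspaces scale) (A_mat scale q \<phi>) c} = {complex_of_real (\<theta> i) |i. i \<le> N}"
proof -
  have "{c. eigenvalue (subspaces scale) (A_mat scale q \<phi>) c} =
      (\<lambda>W. complex_of_real (\<theta> (dim W))) ` subspaces scale"
    by (rule finite_eigenbasis(1)[where F = eigvec, OF finite_sets finite_sets refl])
      (rule eigvec_eigenspace, simp add: subspaces_def, rule eigvec_independent)
  \<comment> \<open>Every dimension up to \<open>N\<close> occurs, so each \<open>\<theta> i\<close>
    is attained.\<close>
  moreover have "\<exists>W. subspace W \<and> dim W = i" if "i \<le> N" for i
    using choose_subspace_of_subspace[OF that] by metis
  ultimately show ?thesis
    using dim_le_N by (fastforce simp: subspaces_def simp del: dim_UNIV)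
qed

lemma dim_eigenspace_A:
  assumes "i \<le> N"
  shows "real (cfun.dim (eigenspace (subspaces scale) (A_mat scale q \<phi>) (complex_of_real (\<theta> i)))) =
    q_binom q N i"
proof -
  have "cfun.dim (eigenspace (subspaces scale) (A_mat scale q \<phi>) (complex_of_real (\<theta> i))) =
      card {W \<in> subspaces scale. complex_of_real (\<theta> (dim W)) = complex_of_real (\<theta> i)}"
    by (rule finite_eigenbasis(2)[where F = eigvec, OF finite_sets finite_sets refl])
      (rule eigvec_eigenspace, simp add: subspaces_def, rule eigvec_independent)
  \<comment> \<open>The \<open>\<theta> i\<close> are distinct, so equal eigenvalues mean equal
    dimensions.\<close>
  also have "{W \<in> subspaces scale. complex_of_real (\<theta> (dim W)) = complex_of_real (\<theta> i)} =
      {W. subspace W \<and> dim W = i}"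
    using theta_eq_iff[OF q_ge_2 phi_pos dim_le_N assms]
    by (auto simp: subspaces_def simp del: dim_UNIV)
  finally show ?thesis using card_subspaces_of_dim[OF assms] by simp
qed

end

theorem proposition10p7:
  fixes scale :: "'k::{field,finite} \<Rightarrow> 'v::ab_group_add \<Rightarrow> 'v"
    and q N :: nat and \<phi> :: real
  assumes "CARD('k) = q"
    and "vector_space scale"
    and "vector_space.dim scale (UNIV :: 'v set) = N"
    and "N \<ge> 1"
    and "\<phi> > 0"
  shows "{c. eigenvalue (subspaces scale) (A_mat scale q \<phi>) c}
           = {complex_of_real (theta q \<phi> N i) | i. i \<le> N}
       \<and> (\<forall>i\<le>N. real (cfun.dim (eigenspace (subspaces scale) (A_mat scale q \<phi>)
                                  (complex_of_real (theta q \<phi> N i))))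
                = q_binom q N i)"
proof -
  interpret V: vector_space scale by fact
  obtain B where B: "V.independent B" "UNIV \<subseteq> V.span B" "card B = N"
    using V.basis_exists[of UNIV] assms(3) by metis
  \<comment> \<open>An infinite set has \<open>card\<close> 0, so \<open>card B = N\<close> with
    \<open>N \<ge> 1\<close> makes the basis finite.\<close>
  interpret weighted_projective_geometry scale B q \<phi>
    by unfold_locales (use assms B card_ge_0_finite[of B] in auto)
  show ?thesis
    using eigenvalues_A dim_eigenspace_A by (simp only: assms(3)) blast
qed

end
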